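(* For nonzero complex parameters $\beta_1,\beta_2$ define the map $R(\beta_1,\beta_2):(x,y)\mapsto(p,q)$ by $$(p^1,p^2)=\left(\frac{(1+x^1)(1+y^1)}{1+x^1P}-1,\;y^2P^{-1}\right),\qquad (q^1,q^2)=\left(x^1P,\;\frac{(1-x^2)(1-y^2)}{y^2P^{-1}-1}+1\right),$$ $$P=\frac{\beta_1(1-y^2)+\beta_2\,y^2(1+x^1)}{\beta_1x^1(y^2-1)+\beta_2(1+x^1)}.$$ Then: (a) whenever $u,v,u_{(1)},v_{(1)},u_{(2)},v_{(2)},u_{(1,2)},v_{(1,2)}$ satisfy $$u_{(1,2)}=u+\Big(\frac1{\beta_1}-\frac1{\beta_2}\Big)\frac{\beta_1\beta_2(u+v_{(2)})(u_{(1)}-u)}{\beta_2(u+v_{(2)})+\beta_1(u_{(1)}-u)},\qquad v_{(1,2)}=v+\Big(\frac1{\beta_2}-\frac1{\beta_1}\Big)\frac{\beta_1\beta_2(v+u_{(1)})(v_{(2)}-v)}{\beta_1(v+u_{(1)})+\beta_2(v_{(2)}-v)},$$ the quantities $$x=\Big(\frac{u-u_{(1)}}{v+u_{(1)}},\frac{v-v_{(1)}}{v+u_{(1)}}\Big),\quad y=\Big(\frac{u_{(2)}-u}{u+v_{(2)}},\frac{v_{(2)}-v}{u+v_{(2)}}\Big),$$ $$p=\Big(\frac{u_{(2)}-u_{(1,2)}}{v_{(2)}+u_{(1,2)}},\frac{v_{(2)}-v_{(1,2)}}{v_{(2)}+u_{(1,2)}}\Big),\quad q=\Big(\frac{u_{(1,2)}-u_{(1)}}{u_{(1)}+v_{(1,2)}},\frac{v_{(1,2)}-v_{(1)}}{u_{(1)}+v_{(1,2)}}\Big)$$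 satisfy $(p,q)=R(\beta_1,\beta_2)(x,y)$; (b) $R$ satisfies the parameter-dependent Yang-Baxter relation $$R^{(2,3)}(\beta_2,\beta_3)\,R^{(1,3)}(\beta_1,\beta_3)\,R^{(1,2)}(\beta_1,\beta_2)=R^{(1,2)}(\beta_1,\beta_2)\,R^{(1,3)}(\beta_1,\beta_3)\,R^{(2,3)}(\beta_2,\beta_3).$$
   Context: Here $x=(x^1,x^2)$, etc.; upper indices on $x,y,p,q$ denote components, not powers (except $P^{-1}=1/P$). All variables are complex scalars; identities are understood for generic values, where all expressions are defined (equalities of rational maps). $R^{(i,j)}$ acts on triples $(x,y,z)$ of elements of $\mathbb{C}^2$ as $R$ on the $i$-th and $j$-th entries (in this order) and as the identity on the remaining entry; products are compositions. Subscripts in parentheses are just names for the (shifted) field values on the vertices of an elementary square. *)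

theory Defs
  imports "HOL-Analysis.Analysis"
begin

text \<open>
  Rational maps are represented by total functions (with the convention \<open>a / 0 = 0\<close>) together
  with an explicit set of points at which no denominator vanishes.  The value of a function
  outside that set carries no meaning.
\<close>

type_synonym C2 = "complex \<times> complex"

definition yb_num :: "complex \<Rightarrow> complex \<Rightarrow> C2 \<Rightarrow> C2 \<Rightarrow> complex" where
  "yb_num \<beta>1 \<beta>2 = (\<lambda>(x1, x2) (y1, y2). \<beta>1 * (1 - y2) + \<beta>2 * y2 * (1 + x1))"

definition yb_den :: "complex \<Rightarrow> complex \<Rightarrow> C2 \<Rightarrow> C2 \<Rightarrow> complex" where
  "yb_den \<beta>1 \<beta>2 = (\<lambda>(x1, x2) (y1, y2). \<beta>1 * x1 * (y2 - 1) + \<beta>2 * (1 + x1))"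

definition yb_P :: "complex \<Rightarrow> complex \<Rightarrow> C2 \<Rightarrow> C2 \<Rightarrow> complex" where
  "yb_P \<beta>1 \<beta>2 x y = yb_num \<beta>1 \<beta>2 x y / yb_den \<beta>1 \<beta>2 x y"

definition yb_R :: "complex \<Rightarrow> complex \<Rightarrow> C2 \<times> C2 \<Rightarrow> C2 \<times> C2" where
  "yb_R \<beta>1 \<beta>2 = (\<lambda>((x1, x2), (y1, y2)).
     let P = yb_P \<beta>1 \<beta>2 (x1, x2) (y1, y2) in
     (((1 + x1) * (1 + y1) / (1 + x1 * P) - 1, y2 * inverse P),
      (x1 * P, (1 - x2) * (1 - y2) / (y2 * inverse P - 1) + 1)))"

definition yb_R_dom :: "complex \<Rightarrow> complex \<Rightarrow> (C2 \<times> C2) set" where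
  "yb_R_dom \<beta>1 \<beta>2 = {((x1, x2), (y1, y2)).
     let P = yb_P \<beta>1 \<beta>2 (x1, x2) (y1, y2) in
     yb_den \<beta>1 \<beta>2 (x1, x2) (y1, y2) \<noteq> 0 \<and> P \<noteq> 0 \<and>
     1 + x1 * P \<noteq> 0 \<and> y2 * inverse P - 1 \<noteq> 0}"

definition act12 :: "('a \<times> 'a \<Rightarrow> 'a \<times> 'a) \<Rightarrow> 'a \<times> 'a \<times> 'a \<Rightarrow> 'a \<times> 'a \<times> 'a" where
  "act12 f = (\<lambda>(x, y, z). let (p, q) = f (x, y) in (p, q, z))"

definition act13 :: "('a \<times> 'a \<Rightarrow> 'a \<times> 'a) \<Rightarrow> 'a \<times> 'a \<times> 'a \<Rightarrow> 'a \<times> 'a \<times> 'a" where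
  "act13 f = (\<lambda>(x, y, z). let (p, q) = f (x, z) in (p, y, q))"

definition act23 :: "('a \<times> 'a \<Rightarrow> 'a \<times> 'a) \<Rightarrow> 'a \<times> 'a \<times> 'a \<Rightarrow> 'a \<times> 'a \<times> 'a" where
  "act23 f = (\<lambda>(x, y, z). let (p, q) = f (y, z) in (x, p, q))"

definition dom12 :: "('a \<times> 'a) set \<Rightarrow> ('a \<times> 'a \<times> 'a) set" where
  "dom12 D = {(x, y, z). (x, y) \<in> D}"

definition dom13 :: "('a \<times> 'a) set \<Rightarrow> ('a \<times> 'a \<times> 'a) set" where
  "dom13 D = {(x, y, z). (x, z) \<in> D}"

definition dom23 :: "('a \<times> 'a) set \<Rightarrow> ('a \<times> 'a \<times> 'a) set" where
  "dom23 D = {(x, y, z). (y, z) \<in> D}"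

text \<open>The triples at which every factor of the left, resp. right, composition is defined.\<close>

definition yb_left_dom :: "complex \<Rightarrow> complex \<Rightarrow> complex \<Rightarrow> (C2 \<times> C2 \<times> C2) set" where
  "yb_left_dom \<beta>1 \<beta>2 \<beta>3 = {t.
     t \<in> dom12 (yb_R_dom \<beta>1 \<beta>2) \<and>
     act12 (yb_R \<beta>1 \<beta>2) t \<in> dom13 (yb_R_dom \<beta>1 \<beta>3) \<and>
     (act13 (yb_R \<beta>1 \<beta>3) \<circ> act12 (yb_R \<beta>1 \<beta>2)) t \<in> dom23 (yb_R_dom \<beta>2 \<beta>3)}"

definition yb_right_dom :: "complex \<Rightarrow> complex \<Rightarrow> complex \<Rightarrow> (C2 \<times> C2 \<times> C2) set" where
  "yb_right_dom \<beta>1 \<beta>2 \<beta>3 = {t.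
     t \<in> dom23 (yb_R_dom \<beta>2 \<beta>3) \<and>
     act23 (yb_R \<beta>2 \<beta>3) t \<in> dom13 (yb_R_dom \<beta>1 \<beta>3) \<and>
     (act13 (yb_R \<beta>1 \<beta>3) \<circ> act23 (yb_R \<beta>2 \<beta>3)) t \<in> dom12 (yb_R_dom \<beta>1 \<beta>2)}"

text \<open>The lattice system on an elementary square; \<open>u1\<close>, \<open>u2\<close>, \<open>u12\<close> are the shifted fields.\<close>

definition square_system ::
  "complex \<Rightarrow> complex \<Rightarrow> complex \<Rightarrow> complex \<Rightarrow> complex \<Rightarrow> complex \<Rightarrow> complex \<Rightarrow> complex \<Rightarrow> bool" where
  "square_system \<beta>1 \<beta>2 u v u1 v2 u12 v12 \<longleftrightarrow>
     u12 = u + (1 / \<beta>1 - 1 / \<beta>2) *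
       (\<beta>1 * \<beta>2 * (u + v2) * (u1 - u) / (\<beta>2 * (u + v2) + \<beta>1 * (u1 - u))) \<and>
     v12 = v + (1 / \<beta>2 - 1 / \<beta>1) *
       (\<beta>1 * \<beta>2 * (v + u1) * (v2 - v) / (\<beta>1 * (v + u1) + \<beta>2 * (v2 - v)))"

text \<open>
  Variables attached to the edges of the square.  Writing the values at the far ends explicitly,
  the quantity \<open>p\<close> is \<open>edge1\<close> on the edge from \<open>(u2, v2)\<close> to \<open>(u12, v12)\<close>, and \<open>q\<close> is \<open>edge2\<close>
  on the edge from \<open>(u1, v1)\<close> to \<open>(u12, v12)\<close>.
\<close>

definition edge1 :: "complex \<Rightarrow> complex \<Rightarrow> complex \<Rightarrow> complex \<Rightarrow> C2" where
  "edge1 u v u1 v1 = ((u - u1) / (v + u1), (v - v1) / (v + u1))"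

definition edge2 :: "complex \<Rightarrow> complex \<Rightarrow> complex \<Rightarrow> complex \<Rightarrow> C2" where
  "edge2 u v u2 v2 = ((u2 - u) / (u + v2), (v2 - v) / (u + v2))"

definition square_defined ::
  "complex \<Rightarrow> complex \<Rightarrow> complex \<Rightarrow> complex \<Rightarrow> complex \<Rightarrow> complex \<Rightarrow> complex \<Rightarrow> complex \<Rightarrow>
   complex \<Rightarrow> complex \<Rightarrow> bool" where
  "square_defined \<beta>1 \<beta>2 u v u1 v1 u2 v2 u12 v12 \<longleftrightarrow>
     \<beta>2 * (u + v2) + \<beta>1 * (u1 - u) \<noteq> 0 \<and> \<beta>1 * (v + u1) + \<beta>2 * (v2 - v) \<noteq> 0 \<and>
     v + u1 \<noteq> 0 \<and> u + v2 \<noteq> 0 \<and> v2 + u12 \<noteq> 0 \<and> u1 + v12 \<noteq> 0 \<and>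
     (edge1 u v u1 v1, edge2 u v u2 v2) \<in> yb_R_dom \<beta>1 \<beta>2"

end

theory Submission
  imports Defs
begin

text \<open>
  Attach to every vertex of the square lattice the pair \<open>(u, V)\<close> with \<open>V = - v\<close>.  The lattice system
  then says that the vertex in the middle of a path \<open>L, M, R\<close> is replaced by \<open>M'\<close>, where both
  components of \<open>M'\<close> arise from those of \<open>M\<close> by one and the same Moebius map: the map \<open>w\<close> of \<open>z\<close> with
  \<open>\<beta>2 (a - w) (z - c) = \<beta>1 (a - z) (w - c)\<close>, whose fixed points \<open>a\<close> and \<open>c\<close> are the first component
  of \<open>L\<close> and the second component of \<open>R\<close>.  The edge variables of the lattice all have the form
  \<open>edge L M\<close> for a path read from left to right, with \<open>x\<close> and \<open>y\<close> on the path through \<open>M\<close> and \<open>q\<close>,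
  \<open>p\<close> on the one through \<open>M'\<close>.  Every denominator of the Yang-Baxter map factors in these
  coordinates, so the map is exactly the flip \<open>M \<mapsto> M'\<close> (\<open>yb_R_edge\<close>), which is the claim on the
  lattice system.

  For the Yang-Baxter relation, a triple \<open>(x, y, z)\<close> is lifted to a path of four vertices.  Both
  sides of the relation keep the two end vertices and flip the two inner ones three times, in the two
  possible orders, so the relation is the three-dimensional consistency of the flips.  Two flips of one
  inner vertex share a fixed point \<open>a\<close>; moving \<open>a\<close> to infinity turns them into affine maps, whose
  multipliers compose as required.  What remains is the equality of the second fixed points, an identity
  between three values on the cube (\<open>mob_tetrahedron\<close>).  The other inner vertex follows by reversing the
  path, which exchanges \<open>a\<close> with \<open>c\<close> and \<open>\<beta>1\<close> with \<open>\<beta>2\<close>.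

  The triples at which both compositions are defined are dense because the flip is undone by the flip with
  the parameters exchanged.  Hence the Yang-Baxter map is a homeomorphism between open dense sets, and
  pulling back open dense sets along it gives open dense sets again.
\<close>

section \<open>Moebius maps with two prescribed fixed points\<close>

definition mob_den :: "complex \<Rightarrow> complex \<Rightarrow> complex \<Rightarrow> complex \<Rightarrow> complex \<Rightarrow> complex" where
  "mob_den \<beta>1 \<beta>2 a c z = \<beta>2 * (z - c) + \<beta>1 * (a - z)"

text \<open>
  The Moebius map with fixed points \<open>a\<close> and \<open>c\<close> and multiplier \<open>\<beta>1 / \<beta>2\<close>: its value \<open>w\<close> satisfies
  \<open>\<beta>2 (a - w) (z - c) = \<beta>1 (a - z) (w - c)\<close>.
\<close>

definition mob :: "complex \<Rightarrow> complex \<Rightarrow> complex \<Rightarrow> complex \<Rightarrow> complex \<Rightarrow> complex" where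
  "mob \<beta>1 \<beta>2 a c z = (\<beta>2 * a * (z - c) + \<beta>1 * c * (a - z)) / mob_den \<beta>1 \<beta>2 a c z"

lemma mob_den_mirror: "mob_den \<beta>2 \<beta>1 c a z = - mob_den \<beta>1 \<beta>2 a c z"
  by (simp add: mob_den_def algebra_simps)

lemma mob_mirror: "mob \<beta>2 \<beta>1 c a z = mob \<beta>1 \<beta>2 a c z"
proof -
  have "\<beta>1 * c * (z - a) + \<beta>2 * a * (c - z) = - (\<beta>2 * a * (z - c) + \<beta>1 * c * (a - z))"
    by (simp add: algebra_simps)
  then show ?thesis
    by (simp only: mob_def mob_den_mirror[of \<beta>2 \<beta>1 c a z] minus_divide_divide)
qed

text \<open>
  The edge variables of a flipped path are quotients of distances between a vertex component and a fixed
  point, so these two formulas are all that is used of the flip there.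
\<close>

lemma mob_fixed_distances:
  assumes "mob_den \<beta>1 \<beta>2 a c z \<noteq> 0"
  shows "a - mob \<beta>1 \<beta>2 a c z = \<beta>1 * (a - z) * (a - c) / mob_den \<beta>1 \<beta>2 a c z"
    and "mob \<beta>1 \<beta>2 a c z - c = \<beta>2 * (z - c) * (a - c) / mob_den \<beta>1 \<beta>2 a c z"
  using assms unfolding mob_def
  by (simp_all add: field_simps, simp_all add: mob_den_def algebra_simps)

lemma mob_displacement:
  assumes "mob_den \<beta>1 \<beta>2 a c z \<noteq> 0"
  shows "mob \<beta>1 \<beta>2 a c z - z = (\<beta>2 - \<beta>1) * (z - c) * (a - z) / mob_den \<beta>1 \<beta>2 a c z"
  using assms unfolding mob_def
  by (simp add: field_simps) (simp add: mob_den_def algebra_simps)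

lemma mob_diff:
  assumes "mob_den \<beta>1 \<beta>2 a c z \<noteq> 0" "mob_den \<beta>1 \<beta>2 a c z' \<noteq> 0"
  shows "mob \<beta>1 \<beta>2 a c z - mob \<beta>1 \<beta>2 a c z' =
    \<beta>1 * \<beta>2 * (a - c)\<^sup>2 * (z - z') / (mob_den \<beta>1 \<beta>2 a c z * mob_den \<beta>1 \<beta>2 a c z')"
  using assms unfolding mob_def
  by (simp add: field_simps) (simp add: mob_den_def power2_eq_square algebra_simps)

lemma mob_den_mob:
  assumes "mob_den \<beta>1 \<beta>2 a c z \<noteq> 0"
  shows "mob_den \<beta>2 \<beta>1 a c (mob \<beta>1 \<beta>2 a c z) = \<beta>1 * \<beta>2 * (a - c)\<^sup>2 / mob_den \<beta>1 \<beta>2 a c z"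
proof -
  let ?w = "mob \<beta>1 \<beta>2 a c z"
  have "mob_den \<beta>2 \<beta>1 a c ?w = \<beta>1 * (?w - c) + \<beta>2 * (a - ?w)"
    by (simp add: mob_den_def)
  also have "\<dots> = \<beta>1 * \<beta>2 * (a - c)\<^sup>2 / mob_den \<beta>1 \<beta>2 a c z"
    unfolding mob_fixed_distances[OF assms]
    by (simp add: add_divide_distrib[symmetric] power2_eq_square algebra_simps)
  finally show ?thesis .
qed

lemma mob_eqI:
  assumes "mob_den \<beta>1 \<beta>2 a c z \<noteq> 0"
    and "(a - w) * mob_den \<beta>1 \<beta>2 a c z = \<beta>1 * (a - z) * (a - c)"
  shows "w = mob \<beta>1 \<beta>2 a c z"
proof -
  have "a - w = a - mob \<beta>1 \<beta>2 a c z"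
    using assms by (simp add: mob_fixed_distances(1) field_simps)
  then show ?thesis by simp
qed

lemma mob_inverse:
  assumes "\<beta>1 \<noteq> 0" "\<beta>2 \<noteq> 0" "a \<noteq> c" "mob_den \<beta>1 \<beta>2 a c z \<noteq> 0"
  shows "mob \<beta>2 \<beta>1 a c (mob \<beta>1 \<beta>2 a c z) = z"
proof (rule mob_eqI[symmetric])
  show "mob_den \<beta>2 \<beta>1 a c (mob \<beta>1 \<beta>2 a c z) \<noteq> 0"
    using assms by (simp add: mob_den_mob)
  show "(a - z) * mob_den \<beta>2 \<beta>1 a c (mob \<beta>1 \<beta>2 a c z) =
      \<beta>2 * (a - mob \<beta>1 \<beta>2 a c z) * (a - c)"
    using assms by (simp add: mob_den_mob mob_fixed_distances(1) power2_eq_square)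
qed

text \<open>
  The inner vertices of a path have the first component \<open>e\<close> (left) and the second component \<open>f\<close>
  (right); \<open>a\<close> and \<open>d\<close> come from the end vertices.  The identity relates the fixed points \<open>f\<close>, \<open>f'\<close>
  and \<open>g\<close> of the three flips of the left inner vertex: in the coordinate \<open>1 / (z - a)\<close> it says that
  the fixed point of the composite of the affine flips with fixed points \<open>f\<close> and \<open>f'\<close> is \<open>g\<close>.
  With \<open>a = 0\<close> and denominators cleared, \<open>f'\<close> and \<open>g\<close> acquire the same numerator \<open>K\<close>, and the
  claim reduces to a linear relation between \<open>K\<close> and the denominators \<open>G\<close> and \<open>H\<close>.
\<close>

lemma mob_tetrahedron:
  assumes e': "e' = mob \<beta>1 \<beta>2 a f e" "mob_den \<beta>1 \<beta>2 a f e \<noteq> 0"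
    and f': "f' = mob \<beta>1 \<beta>3 e' d f" "mob_den \<beta>1 \<beta>3 e' d f \<noteq> 0"
    and g: "g = mob \<beta>2 \<beta>3 e d f" "mob_den \<beta>2 \<beta>3 e d f \<noteq> 0"
  shows "\<beta>2 * (\<beta>1 - \<beta>3) * (f - a) * (f' - a) =
    (g - a) * (\<beta>3 * (\<beta>1 - \<beta>2) * (f' - a) + \<beta>1 * (\<beta>2 - \<beta>3) * (f - a))"
proof -
  define E F D where "E = e - a" and "F = f - a" and "D = d - a"
  have vars: "e = E + a" "f = F + a" "d = D + a"
    by (simp_all add: E_def F_def D_def)
  define h where "h = mob_den \<beta>1 \<beta>2 a f e"
  define K where "K = \<beta>3 * E * (F - D) + \<beta>2 * D * (E - F)"
  define G where "G = h * mob_den \<beta>1 \<beta>3 e' d f"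
  define H where "H = mob_den \<beta>2 \<beta>3 e d f"
  have h: "h = - (\<beta>2 * F + (\<beta>1 - \<beta>2) * E)"
    by (simp add: h_def mob_den_def vars algebra_simps)
  have h0: "h \<noteq> 0" "G \<noteq> 0" "H \<noteq> 0"
    using assms by (simp_all add: h_def G_def H_def)
  have e1: "h * (e' - a) = - \<beta>1 * E * F"
  proof -
    have "a - e' = \<beta>1 * (a - e) * (a - f) / h"
      using mob_fixed_distances(1)[OF e'(2)] by (simp add: e'(1) h_def)
    then have "h * (a - e') = \<beta>1 * (a - e) * (a - f)"
      using h0 by simp
    then show ?thesis by (simp add: vars algebra_simps)
  qed
  have e2: "h * e' = h * a - \<beta>1 * E * F"
    using e1 by (simp add: algebra_simps)
  have G: "G = \<beta>3 * (F - D) * h - \<beta>1 * \<beta>2 * F * (E - F)"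
  proof -
    have "G = \<beta>3 * (F - D) * h + \<beta>1 * (h * e' - h * f)"
      by (simp add: G_def mob_den_def vars algebra_simps)
    also have "h * e' - h * f = - \<beta>2 * F * (E - F)"
      unfolding e2 by (simp add: h vars algebra_simps)
    finally show ?thesis by (simp add: algebra_simps)
  qed
  have f1: "G * (f' - a) = - \<beta>1 * F * K"
  proof -
    have "mob_den \<beta>1 \<beta>3 e' d f * f' = \<beta>3 * e' * (f - d) + \<beta>1 * d * (e' - f)"
      using f' by (simp add: mob_def)
    then have "G * f' = h * (\<beta>3 * e' * (f - d) + \<beta>1 * d * (e' - f))"
      by (simp add: G_def)
    also have "\<dots> = \<beta>3 * (h * e') * (f - d) + \<beta>1 * d * (h * e' - h * f)"
      by (simp add: algebra_simps)
    also have "\<dots> - G * a = - \<beta>1 * F * K"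
      unfolding e2 G by (simp add: h K_def vars algebra_simps)
    finally show ?thesis by (simp add: algebra_simps)
  qed
  have g1: "H * (g - a) = K"
  proof -
    have "H * g = \<beta>3 * e * (f - d) + \<beta>2 * d * (e - f)"
      using g by (simp add: mob_def H_def)
    then show ?thesis
      by (simp add: H_def mob_den_def K_def vars algebra_simps)
  qed
  have key: "\<beta>2 * (\<beta>1 - \<beta>3) * F * H = \<beta>3 * (\<beta>1 - \<beta>2) * K - (\<beta>2 - \<beta>3) * G"
    unfolding G h by (simp add: H_def mob_den_def K_def vars algebra_simps)
  have "G * H * (\<beta>2 * (\<beta>1 - \<beta>3) * F * (f' - a)) = (\<beta>2 * (\<beta>1 - \<beta>3) * F * H) * (G * (f' - a))"
    by (simp add: algebra_simps)
  also have "\<dots> = (H * (g - a)) * (\<beta>3 * (\<beta>1 - \<beta>2) * (G * (f' - a)) + G * \<beta>1 * (\<beta>2 - \<beta>3) * F)"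
    unfolding key f1 g1 by (simp add: algebra_simps)
  also have "\<dots> = G * H * ((g - a) * (\<beta>3 * (\<beta>1 - \<beta>2) * (f' - a) + \<beta>1 * (\<beta>2 - \<beta>3) * F))"
    by (simp add: algebra_simps)
  finally show ?thesis
    using h0 by (simp add: F_def)
qed

text \<open>
  The argument \<open>z\<close> is not tied to \<open>e\<close>, so that the identity applies to both components of the flipped
  vertex.  The proof works with \<open>z - a\<close> rather than its reciprocal to include \<open>z = a\<close>.
\<close>

lemma mob_consistent:
  assumes e': "e' = mob \<beta>1 \<beta>2 a f e" "mob_den \<beta>1 \<beta>2 a f e \<noteq> 0"
    and f': "f' = mob \<beta>1 \<beta>3 e' d f" "mob_den \<beta>1 \<beta>3 e' d f \<noteq> 0"
    and g: "g = mob \<beta>2 \<beta>3 e d f" "mob_den \<beta>2 \<beta>3 e d f \<noteq> 0"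
    and z: "mob_den \<beta>1 \<beta>2 a f z \<noteq> 0" "mob_den \<beta>2 \<beta>3 a f' (mob \<beta>1 \<beta>2 a f z) \<noteq> 0"
      "mob_den \<beta>1 \<beta>3 a g z \<noteq> 0"
  shows "mob \<beta>2 \<beta>3 a f' (mob \<beta>1 \<beta>2 a f z) = mob \<beta>1 \<beta>3 a g z"
proof (rule mob_eqI[OF z(3)])
  define w y where "w = mob \<beta>1 \<beta>2 a f z" and "y = mob \<beta>2 \<beta>3 a f' w"
  define m where "m = mob_den \<beta>1 \<beta>2 a f z"
  define n where "n = mob_den \<beta>2 \<beta>3 a f' w"
  have nz: "m \<noteq> 0" "n \<noteq> 0" using z by (simp_all add: m_def n_def w_def)
  have w: "m * (a - w) = \<beta>1 * (a - z) * (a - f)"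
    using mob_fixed_distances(1)[OF z(1)] nz by (simp add: w_def m_def)
  have y: "n * (a - y) = \<beta>2 * (a - w) * (a - f')"
    using mob_fixed_distances(1)[OF z(2)] nz by (simp add: w_def n_def y_def)
  have m: "m = (\<beta>2 - \<beta>1) * (z - a) - \<beta>2 * (f - a)"
    by (simp add: m_def mob_den_def algebra_simps)
  have n: "n = (\<beta>2 - \<beta>3) * (a - w) - \<beta>3 * (f' - a)"
    by (simp add: n_def mob_den_def algebra_simps)
  have mn: "m * n = (\<beta>2 - \<beta>3) * (\<beta>1 * (a - z) * (a - f)) - \<beta>3 * (f' - a) * m"
    unfolding n w[symmetric] by (simp add: algebra_simps)
  have t: "\<beta>2 * (\<beta>1 - \<beta>3) * (f - a) * (f' - a) =
    (g - a) * (\<beta>3 * (\<beta>1 - \<beta>2) * (f' - a) + \<beta>1 * (\<beta>2 - \<beta>3) * (f - a))"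
    by (rule mob_tetrahedron[OF e' f' g])
  have d: "mob_den \<beta>1 \<beta>3 a g z = (\<beta>3 - \<beta>1) * (z - a) - \<beta>3 * (g - a)"
    by (simp add: mob_den_def algebra_simps)
  have "m * n * ((a - y) * mob_den \<beta>1 \<beta>3 a g z) =
      m * (n * (a - y)) * mob_den \<beta>1 \<beta>3 a g z"
    by (simp only: mult_ac)
  also have "\<dots> = \<beta>2 * (m * (a - w)) * (a - f') * mob_den \<beta>1 \<beta>3 a g z"
    unfolding y by (simp only: mult_ac)
  also have "\<dots> = \<beta>1 * (z - a) *
      ((z - a) * (\<beta>2 * (\<beta>1 - \<beta>3) * (f - a) * (f' - a)) + \<beta>2 * \<beta>3 * (f - a) * (f' - a) * (g - a))"
    unfolding w d by (simp add: algebra_simps)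
  also have "\<dots> = m * n * (\<beta>1 * (a - z) * (a - g))"
    unfolding t mn unfolding m by (simp add: algebra_simps)
  finally show "(a - mob \<beta>2 \<beta>3 a f' (mob \<beta>1 \<beta>2 a f z)) * mob_den \<beta>1 \<beta>3 a g z =
      \<beta>1 * (a - z) * (a - g)"
    using nz by (simp add: y_def w_def)
qed

section \<open>The map on edges of a path\<close>

text \<open>
  Vertices are pairs \<open>(u, - v)\<close>.  With this sign the two components of a vertex are moved by the same
  Moebius map, and the two kinds of edge variables of the lattice have a common form.
\<close>

definition edge :: "C2 \<Rightarrow> C2 \<Rightarrow> C2" where
  "edge L M = ((fst M - fst L) / (fst L - snd M), (snd L - snd M) / (fst L - snd M))"

definition flip :: "complex \<Rightarrow> complex \<Rightarrow> C2 \<Rightarrow> C2 \<Rightarrow> C2 \<Rightarrow> C2" where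
  "flip \<beta>1 \<beta>2 L R M = map_prod (mob \<beta>1 \<beta>2 (fst L) (snd R)) (mob \<beta>1 \<beta>2 (fst L) (snd R)) M"

text \<open>
  The two denominators of the map outside \<open>P\<close> split into factors of the variables, because
  \<open>yb_den + x1 * yb_num\<close> and \<open>y2 * yb_den - yb_num\<close> do.  Here \<open>1 + x1 * y2\<close> is the common factor.
\<close>

lemma yb_R_factors:
  assumes "yb_den \<beta>1 \<beta>2 (x1, x2) (y1, y2) \<noteq> 0" "yb_num \<beta>1 \<beta>2 (x1, x2) (y1, y2) \<noteq> 0"
  shows "1 + x1 * yb_P \<beta>1 \<beta>2 (x1, x2) (y1, y2) =
      \<beta>2 * (1 + x1) * (1 + x1 * y2) / yb_den \<beta>1 \<beta>2 (x1, x2) (y1, y2)"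
    and "y2 * inverse (yb_P \<beta>1 \<beta>2 (x1, x2) (y1, y2)) - 1 =
      - (\<beta>1 * (1 - y2) * (1 + x1 * y2) / yb_num \<beta>1 \<beta>2 (x1, x2) (y1, y2))"
proof -
  let ?D = "yb_den \<beta>1 \<beta>2 (x1, x2) (y1, y2)" and ?N = "yb_num \<beta>1 \<beta>2 (x1, x2) (y1, y2)"
  have "?D + x1 * ?N = \<beta>2 * (1 + x1) * (1 + x1 * y2)"
    by (simp add: yb_den_def yb_num_def algebra_simps)
  then show "1 + x1 * yb_P \<beta>1 \<beta>2 (x1, x2) (y1, y2) = \<beta>2 * (1 + x1) * (1 + x1 * y2) / ?D"
    using assms by (simp add: yb_P_def field_simps)
  have "y2 * ?D - ?N = - (\<beta>1 * (1 - y2) * (1 + x1 * y2))"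
    by (simp add: yb_den_def yb_num_def algebra_simps)
  moreover have "y2 * inverse (?N / ?D) - 1 = (y2 * ?D - ?N) / ?N"
    using assms by (simp add: diff_divide_distrib)
  ultimately show "y2 * inverse (yb_P \<beta>1 \<beta>2 (x1, x2) (y1, y2)) - 1 =
      - (\<beta>1 * (1 - y2) * (1 + x1 * y2) / ?N)"
    by (simp add: yb_P_def)
qed

lemma yb_R_dom_iff:
  assumes "\<beta>1 \<noteq> 0" "\<beta>2 \<noteq> 0"
  shows "((x1, x2), (y1, y2)) \<in> yb_R_dom \<beta>1 \<beta>2 \<longleftrightarrow>
    yb_den \<beta>1 \<beta>2 (x1, x2) (y1, y2) \<noteq> 0 \<and> yb_num \<beta>1 \<beta>2 (x1, x2) (y1, y2) \<noteq> 0 \<and>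
    1 + x1 \<noteq> 0 \<and> 1 - y2 \<noteq> 0 \<and> 1 + x1 * y2 \<noteq> 0"
proof (cases "yb_den \<beta>1 \<beta>2 (x1, x2) (y1, y2) = 0 \<or> yb_num \<beta>1 \<beta>2 (x1, x2) (y1, y2) = 0")
  case True
  then show ?thesis by (auto simp: yb_R_dom_def yb_P_def)
next
  case False
  then have nz: "yb_den \<beta>1 \<beta>2 (x1, x2) (y1, y2) \<noteq> 0" "yb_num \<beta>1 \<beta>2 (x1, x2) (y1, y2) \<noteq> 0"
    by simp_all
  then have "yb_P \<beta>1 \<beta>2 (x1, x2) (y1, y2) \<noteq> 0"
    by (simp add: yb_P_def)
  then show ?thesis
    using assms nz
    by (simp only: yb_R_dom_def yb_R_factors[OF nz] mem_Collect_eq case_prod_conv Let_def)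
      (simp, blast)
qed

lemma yb_R_eq:
  assumes "\<beta>1 \<noteq> 0" "\<beta>2 \<noteq> 0" "((x1, x2), (y1, y2)) \<in> yb_R_dom \<beta>1 \<beta>2"
  defines "D \<equiv> yb_den \<beta>1 \<beta>2 (x1, x2) (y1, y2)" and "N \<equiv> yb_num \<beta>1 \<beta>2 (x1, x2) (y1, y2)"
  shows "yb_R \<beta>1 \<beta>2 ((x1, x2), (y1, y2)) =
    (((1 + y1) * D / (\<beta>2 * (1 + x1 * y2)) - 1, y2 * D / N),
     (x1 * N / D, 1 - (1 - x2) * N / (\<beta>1 * (1 + x1 * y2))))"
proof -
  have nz: "yb_den \<beta>1 \<beta>2 (x1, x2) (y1, y2) \<noteq> 0" "yb_num \<beta>1 \<beta>2 (x1, x2) (y1, y2) \<noteq> 0"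
    and "1 + x1 \<noteq> 0" "1 - y2 \<noteq> 0" "1 + x1 * y2 \<noteq> 0"
    using assms(3) unfolding yb_R_dom_iff[OF assms(1,2)] by simp_all
  then show ?thesis
    using assms(1,2)
    by (simp only: yb_R_def case_prod_conv Let_def yb_R_factors[OF nz])
      (simp add: yb_P_def D_def N_def)
qed

text \<open>
  Every factor occurring in the Yang-Baxter map becomes a difference of vertex components or a
  denominator of the flip.
\<close>

lemma yb_coeff_edge:
  assumes "fst L \<noteq> snd M" "fst M \<noteq> snd R"
  shows "yb_den \<beta>1 \<beta>2 (edge L M) (edge M R) =
      (fst M - snd M) * mob_den \<beta>1 \<beta>2 (fst L) (snd R) (fst M) /
      ((fst L - snd M) * (fst M - snd R))"
    and "yb_num \<beta>1 \<beta>2 (edge L M) (edge M R) =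
      (fst M - snd M) * mob_den \<beta>1 \<beta>2 (fst L) (snd R) (snd M) /
      ((fst L - snd M) * (fst M - snd R))"
    and "1 + fst (edge L M) = (fst M - snd M) / (fst L - snd M)"
    and "1 - snd (edge M R) = (fst M - snd M) / (fst M - snd R)"
    and "1 + fst (edge L M) * snd (edge M R) =
      (fst M - snd M) * (fst L - snd R) / ((fst L - snd M) * (fst M - snd R))"
    and "1 + fst (edge M R) = (fst R - snd R) / (fst M - snd R)"
    and "1 - snd (edge L M) = (fst L - snd L) / (fst L - snd M)"
proof -
  obtain a a' where L: "L = (a, a')" by fastforce
  obtain z z' where M: "M = (z, z')" by fastforce
  obtain c' c where R: "R = (c', c)" by fastforce
  have nz: "a - z' \<noteq> 0" "z - c \<noteq> 0" using assms by (simp_all add: L M R)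
  show "yb_den \<beta>1 \<beta>2 (edge L M) (edge M R) =
      (fst M - snd M) * mob_den \<beta>1 \<beta>2 (fst L) (snd R) (fst M) /
      ((fst L - snd M) * (fst M - snd R))"
    using nz by (simp add: L M R edge_def yb_den_def mob_den_def divide_simps) (simp add: algebra_simps)
  show "yb_num \<beta>1 \<beta>2 (edge L M) (edge M R) =
      (fst M - snd M) * mob_den \<beta>1 \<beta>2 (fst L) (snd R) (snd M) /
      ((fst L - snd M) * (fst M - snd R))"
    using nz by (simp add: L M R edge_def yb_num_def mob_den_def divide_simps) (simp add: algebra_simps)
  show "1 + fst (edge L M) * snd (edge M R) =
      (fst M - snd M) * (fst L - snd R) / ((fst L - snd M) * (fst M - snd R))"
    using nz by (simp add: L M R edge_def divide_simps) (simp add: algebra_simps)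
qed (use assms in \<open>simp_all add: edge_def divide_simps\<close>)

lemma edge_in_yb_R_dom_iff:
  assumes "\<beta>1 \<noteq> 0" "\<beta>2 \<noteq> 0" "fst L \<noteq> snd M" "fst M \<noteq> snd R"
  shows "(edge L M, edge M R) \<in> yb_R_dom \<beta>1 \<beta>2 \<longleftrightarrow>
    fst M \<noteq> snd M \<and> fst L \<noteq> snd R \<and>
    mob_den \<beta>1 \<beta>2 (fst L) (snd R) (fst M) \<noteq> 0 \<and> mob_den \<beta>1 \<beta>2 (fst L) (snd R) (snd M) \<noteq> 0"
proof -
  have "(edge L M, edge M R) \<in> yb_R_dom \<beta>1 \<beta>2 \<longleftrightarrow>
    yb_den \<beta>1 \<beta>2 (edge L M) (edge M R) \<noteq> 0 \<and> yb_num \<beta>1 \<beta>2 (edge L M) (edge M R) \<noteq> 0 \<and>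
    1 + fst (edge L M) \<noteq> 0 \<and> 1 - snd (edge M R) \<noteq> 0 \<and> 1 + fst (edge L M) * snd (edge M R) \<noteq> 0"
    using yb_R_dom_iff[OF assms(1,2), of "fst (edge L M)" "snd (edge L M)"
        "fst (edge M R)" "snd (edge M R)"] by simp
  then show ?thesis
    unfolding yb_coeff_edge[OF assms(3,4)] using assms(3,4) by auto
qed

text \<open>
  The map written in the factors of \<open>yb_coeff_edge\<close> agrees with the distances of the flipped vertex
  from the fixed points, as given by \<open>mob_fixed_distances\<close>.
\<close>

lemma yb_R_edge:
  assumes \<beta>: "\<beta>1 \<noteq> 0" "\<beta>2 \<noteq> 0" and LMR: "fst L \<noteq> snd M" "fst M \<noteq> snd R"
    and dom: "(edge L M, edge M R) \<in> yb_R_dom \<beta>1 \<beta>2"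
    and M': "M' = flip \<beta>1 \<beta>2 L R M"
  shows "yb_R \<beta>1 \<beta>2 (edge L M, edge M R) = (edge M' R, edge L M')"
    and "fst L \<noteq> snd M'" "fst M' \<noteq> snd R"
proof -
  define a c z z' where vars: "a = fst L" "c = snd R" "z = fst M" "z' = snd M"
  define d d' where dd: "d = mob_den \<beta>1 \<beta>2 a c z" "d' = mob_den \<beta>1 \<beta>2 a c z'"
  have "z \<noteq> z'" "a \<noteq> c" and d0: "mob_den \<beta>1 \<beta>2 a c z \<noteq> 0" "mob_den \<beta>1 \<beta>2 a c z' \<noteq> 0"
    using dom unfolding edge_in_yb_R_dom_iff[OF \<beta> LMR] by (simp_all add: vars)
  then have nz: "z - z' \<noteq> 0" "a - c \<noteq> 0" "d \<noteq> 0" "d' \<noteq> 0" "a - z' \<noteq> 0" "z - c \<noteq> 0"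
    using LMR by (simp_all add: vars dd)
  have w: "fst M' - c = \<beta>2 * (z - c) * (a - c) / d" "a - fst M' = \<beta>1 * (a - z) * (a - c) / d"
    using mob_fixed_distances[OF d0(1)] by (simp_all add: M' flip_def vars dd)
  have w': "snd M' - c = \<beta>2 * (z' - c) * (a - c) / d'" "a - snd M' = \<beta>1 * (a - z') * (a - c) / d'"
    using mob_fixed_distances[OF d0(2)] by (simp_all add: M' flip_def vars dd)
  have "fst M' - c \<noteq> 0" "a - snd M' \<noteq> 0"
    unfolding w w' using nz \<beta> by simp_all
  then show M'0: "fst L \<noteq> snd M'" "fst M' \<noteq> snd R"
    by (auto simp: vars)
  have E: "edge L M = ((z - a) / (a - z'), (snd L - z') / (a - z'))"
    "edge M R = ((fst R - z) / (z - c), (z' - c) / (z - c))"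
    by (simp_all add: edge_def vars)
  note co = yb_coeff_edge(1,2)[OF LMR, of \<beta>1 \<beta>2, folded vars, folded dd]
    yb_coeff_edge(3-7)[OF LMR, folded vars]
  have p1: "1 + fst (edge M' R) = (fst R - c) / (fst M' - c)"
    using yb_coeff_edge(6)[OF M'0] by (simp add: vars)
  have q2: "1 - snd (edge L M') = (a - snd L) / (a - snd M')"
    using yb_coeff_edge(7)[OF M'0] by (simp add: vars)
  let ?x = "edge L M" and ?y = "edge M R"
  have "yb_R \<beta>1 \<beta>2 (?x, ?y) =
    (((1 + fst ?y) * yb_den \<beta>1 \<beta>2 ?x ?y / (\<beta>2 * (1 + fst ?x * snd ?y)) - 1,
      snd ?y * yb_den \<beta>1 \<beta>2 ?x ?y / yb_num \<beta>1 \<beta>2 ?x ?y),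
     (fst ?x * yb_num \<beta>1 \<beta>2 ?x ?y / yb_den \<beta>1 \<beta>2 ?x ?y,
      1 - (1 - snd ?x) * yb_num \<beta>1 \<beta>2 ?x ?y / (\<beta>1 * (1 + fst ?x * snd ?y))))"
    using yb_R_eq[OF \<beta>, of "fst ?x" "snd ?x" "fst ?y" "snd ?y"] dom by simp
  moreover have "(1 + fst ?y) * yb_den \<beta>1 \<beta>2 ?x ?y / (\<beta>2 * (1 + fst ?x * snd ?y)) =
      1 + fst (edge M' R)"
    unfolding p1 w co using nz \<beta> by (simp add: mult_ac)
  moreover have "snd ?y * yb_den \<beta>1 \<beta>2 ?x ?y / yb_num \<beta>1 \<beta>2 ?x ?y = snd (edge M' R)"
  proof -
    have "snd (edge M' R) = (snd M' - c) / (fst M' - c)"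
      by (simp add: edge_def vars)
    then show ?thesis
      unfolding w w' co(1,2) unfolding E using nz \<beta> by simp
  qed
  moreover have "fst ?x * yb_num \<beta>1 \<beta>2 ?x ?y / yb_den \<beta>1 \<beta>2 ?x ?y = fst (edge L M')"
  proof -
    have "fst (edge L M') = - (a - fst M') / (a - snd M')"
      by (simp add: edge_def vars)
    then show ?thesis
      unfolding w w' co(1,2) unfolding E using nz \<beta> by (simp add: divide_simps) algebra
  qed
  moreover have "(1 - snd ?x) * yb_num \<beta>1 \<beta>2 ?x ?y / (\<beta>1 * (1 + fst ?x * snd ?y)) =
      1 - snd (edge L M')"
    unfolding q2 w' co using nz \<beta> by simp
  ultimately show "yb_R \<beta>1 \<beta>2 (?x, ?y) = (edge M' R, edge L M')"
    by (simp add: prod_eq_iff)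
qed

text \<open>
  The equation for \<open>snd y\<close> determines the common denominator \<open>m\<close> of the edge variables, and with it
  the vertex.  The last clause allows the construction to be iterated.
\<close>

lemma edge_extend_right:
  assumes "fst M \<noteq> snd M" "snd y \<noteq> 1"
  obtains R where "fst M \<noteq> snd R" "edge M R = y" "fst y \<noteq> -1 \<Longrightarrow> fst R \<noteq> snd R"
proof
  define m where "m = (fst M - snd M) / (1 - snd y)"
  define R where "R = (fst M + m * fst y, fst M - m)"
  have m: "m \<noteq> 0" "m * (1 - snd y) = fst M - snd M"
    using assms by (simp_all add: m_def)
  show "fst M \<noteq> snd R" using m by (simp add: R_def)
  show "edge M R = y"
    using m by (simp add: edge_def R_def prod_eq_iff field_simps)
  have "fst R - snd R = m * (1 + fst y)"
    by (simp add: R_def algebra_simps)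
  then show "fst R \<noteq> snd R" if "fst y \<noteq> -1"
    using m that by (auto simp: add_eq_0_iff)
qed

lemma edge_extend_left:
  assumes "fst M \<noteq> snd M" "fst x \<noteq> -1"
  obtains L where "fst L \<noteq> snd M" "edge L M = x"
proof
  define m where "m = (fst M - snd M) / (1 + fst x)"
  define L where "L = (snd M + m, snd M + m * snd x)"
  have "1 + fst x \<noteq> 0" using assms by (auto simp: add_eq_0_iff)
  then have m: "m \<noteq> 0" "m * (1 + fst x) = fst M - snd M"
    using assms by (simp_all add: m_def)
  show "fst L \<noteq> snd M" using m by (simp add: L_def)
  show "edge L M = x"
    using m by (simp add: edge_def L_def prod_eq_iff field_simps)
qed

lemma yb_R_dom_D:
  assumes "\<beta>1 \<noteq> 0" "\<beta>2 \<noteq> 0" "(x, y) \<in> yb_R_dom \<beta>1 \<beta>2"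
  shows "fst x \<noteq> -1" "snd y \<noteq> 1"
  using assms yb_R_dom_iff[OF assms(1,2), of "fst x" "snd x" "fst y" "snd y"] by auto

section \<open>The Yang-Baxter relation\<close>

theorem yb_R_yang_baxter:
  assumes \<beta>: "\<beta>1 \<noteq> 0" "\<beta>2 \<noteq> 0" "\<beta>3 \<noteq> 0"
    and t: "t \<in> yb_left_dom \<beta>1 \<beta>2 \<beta>3" "t \<in> yb_right_dom \<beta>1 \<beta>2 \<beta>3"
  shows "(act23 (yb_R \<beta>2 \<beta>3) \<circ> act13 (yb_R \<beta>1 \<beta>3) \<circ> act12 (yb_R \<beta>1 \<beta>2)) t =
    (act12 (yb_R \<beta>1 \<beta>2) \<circ> act13 (yb_R \<beta>1 \<beta>3) \<circ> act23 (yb_R \<beta>2 \<beta>3)) t"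
proof -
  obtain x y z where xyz: "t = (x, y, z)" by (cases t)
  have d12: "(x, y) \<in> yb_R_dom \<beta>1 \<beta>2" and d23: "(y, z) \<in> yb_R_dom \<beta>2 \<beta>3"
    using t by (simp_all add: xyz yb_left_dom_def yb_right_dom_def dom12_def dom23_def)
  have ne: "fst x \<noteq> -1" "snd y \<noteq> 1" "fst y \<noteq> -1" "snd z \<noteq> 1"
    using yb_R_dom_D[OF \<beta>(1,2) d12] yb_R_dom_D[OF \<beta>(2,3) d23] by simp_all
  \<comment> \<open>Edges are invariant under translation and scaling, so one vertex may be chosen freely.\<close>
  define s1 where "s1 = (1 :: complex, 0 :: complex)"
  have s1: "fst s1 \<noteq> snd s1" by (simp add: s1_def)
  obtain s0 where s0: "fst s0 \<noteq> snd s1" "edge s0 s1 = x"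
    using edge_extend_left[OF s1 ne(1)] .
  obtain s2 where s2: "fst s1 \<noteq> snd s2" "edge s1 s2 = y" "fst s2 \<noteq> snd s2"
    using edge_extend_right[OF s1 ne(2)] ne(3) by metis
  obtain s3 where s3: "fst s2 \<noteq> snd s3" "edge s2 s3 = z"
    using edge_extend_right[OF s2(3) ne(4)] by metis

  \<comment> \<open>The flips prescribed by the left-hand side: the path becomes s0, t1, s2, s3, then s0, t1, t2, s3,
    and finally s0, t1', t2, s3.\<close>
  define t1 where "t1 = flip \<beta>1 \<beta>2 s0 s2 s1"
  define t2 where "t2 = flip \<beta>1 \<beta>3 t1 s3 s2"
  define t1' where "t1' = flip \<beta>2 \<beta>3 s0 t2 t1"
  have dL1: "(edge s0 s1, edge s1 s2) \<in> yb_R_dom \<beta>1 \<beta>2"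
    using d12 by (simp add: s0 s2)
  note L1 = yb_R_edge[OF \<beta>(1,2) s0(1) s2(1) dL1 t1_def]
  have dL2: "(edge t1 s2, edge s2 s3) \<in> yb_R_dom \<beta>1 \<beta>3"
    using t(1) L1(1) by (simp add: xyz yb_left_dom_def act12_def dom13_def s0 s2 s3)
  note L2 = yb_R_edge[OF \<beta>(1,3) L1(3) s3(1) dL2 t2_def]
  have dL3: "(edge s0 t1, edge t1 t2) \<in> yb_R_dom \<beta>2 \<beta>3"
    using t(1) L1(1) L2(1)
    by (simp add: xyz yb_left_dom_def act12_def act13_def dom23_def s0 s2 s3)
  note L3 = yb_R_edge[OF \<beta>(2,3) L1(2) L2(2) dL3 t1'_def]
  have left: "(act23 (yb_R \<beta>2 \<beta>3) \<circ> act13 (yb_R \<beta>1 \<beta>3) \<circ> act12 (yb_R \<beta>1 \<beta>2)) t =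
      (edge t2 s3, edge t1' t2, edge s0 t1')"
    using L1(1) L2(1) L3(1) by (simp add: xyz act12_def act13_def act23_def s0 s2 s3)

  \<comment> \<open>The right-hand side starts with the other inner vertex: s0, s1, r2, s3, then s0, r1, r2, s3,
    and finally s0, r1, r2', s3.\<close>
  define r2 where "r2 = flip \<beta>2 \<beta>3 s1 s3 s2"
  define r1 where "r1 = flip \<beta>1 \<beta>3 s0 r2 s1"
  define r2' where "r2' = flip \<beta>1 \<beta>2 r1 s3 r2"
  have dR1: "(edge s1 s2, edge s2 s3) \<in> yb_R_dom \<beta>2 \<beta>3"
    using d23 by (simp add: s2 s3)
  note R1 = yb_R_edge[OF \<beta>(2,3) s2(1) s3(1) dR1 r2_def]
  have dR2: "(edge s0 s1, edge s1 r2) \<in> yb_R_dom \<beta>1 \<beta>3"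
    using t(2) R1(1) by (simp add: xyz yb_right_dom_def act23_def dom13_def s0 s2 s3)
  note R2 = yb_R_edge[OF \<beta>(1,3) s0(1) R1(2) dR2 r1_def]
  have dR3: "(edge r1 r2, edge r2 s3) \<in> yb_R_dom \<beta>1 \<beta>2"
    using t(2) R1(1) R2(1)
    by (simp add: xyz yb_right_dom_def act23_def act13_def dom12_def s0 s2 s3)
  note R3 = yb_R_edge[OF \<beta>(1,2) R2(3) R1(3) dR3 r2'_def]
  have right: "(act12 (yb_R \<beta>1 \<beta>2) \<circ> act13 (yb_R \<beta>1 \<beta>3) \<circ> act23 (yb_R \<beta>2 \<beta>3)) t =
      (edge r2' s3, edge r1 r2', edge s0 r1)"
    using R1(1) R2(1) R3(1) by (simp add: xyz act12_def act13_def act23_def s0 s2 s3)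

  note nzs =
    dL1[unfolded edge_in_yb_R_dom_iff[OF \<beta>(1,2) s0(1) s2(1)]]
    dL2[unfolded edge_in_yb_R_dom_iff[OF \<beta>(1,3) L1(3) s3(1)]]
    dL3[unfolded edge_in_yb_R_dom_iff[OF \<beta>(2,3) L1(2) L2(2)]]
    dR1[unfolded edge_in_yb_R_dom_iff[OF \<beta>(2,3) s2(1) s3(1)]]
    dR2[unfolded edge_in_yb_R_dom_iff[OF \<beta>(1,3) s0(1) R1(2)]]
    dR3[unfolded edge_in_yb_R_dom_iff[OF \<beta>(1,2) R2(3) R1(3)]]
  have sel: "fst t1 = mob \<beta>1 \<beta>2 (fst s0) (snd s2) (fst s1)"
    "snd t1 = mob \<beta>1 \<beta>2 (fst s0) (snd s2) (snd s1)"
    "fst t2 = mob \<beta>1 \<beta>3 (fst t1) (snd s3) (fst s2)"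
    "snd t2 = mob \<beta>1 \<beta>3 (fst t1) (snd s3) (snd s2)"
    "fst r2 = mob \<beta>2 \<beta>3 (fst s1) (snd s3) (fst s2)"
    "snd r2 = mob \<beta>2 \<beta>3 (fst s1) (snd s3) (snd s2)"
    "fst r1 = mob \<beta>1 \<beta>3 (fst s0) (snd r2) (fst s1)"
    "snd r1 = mob \<beta>1 \<beta>3 (fst s0) (snd r2) (snd s1)"
    by (simp_all add: t1_def t2_def r1_def r2_def flip_def)
  have "mob \<beta>2 \<beta>3 (fst s0) (snd t2) (mob \<beta>1 \<beta>2 (fst s0) (snd s2) z) =
      mob \<beta>1 \<beta>3 (fst s0) (snd r2) z" if "z \<in> {fst s1, snd s1}" for z
    using that nzs sel by (intro mob_consistent[OF sel(1) _ sel(4) _ sel(6)]) auto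
  then have 1: "t1' = r1"
    by (simp add: t1'_def r1_def flip_def prod_eq_iff sel(1,2))
  \<comment> \<open>The reversed path: s3 takes the role of s0, and the parameters are met in the order 3, 2, 1.\<close>
  have "mob \<beta>2 \<beta>1 (snd s3) (fst r1) (mob \<beta>3 \<beta>2 (snd s3) (fst s1) z) =
      mob \<beta>3 \<beta>1 (snd s3) (fst t1) z" if "z \<in> {fst s2, snd s2}" for z
    using that nzs sel
    by (intro mob_consistent[where e = "snd s2" and d = "fst s0" and e' = "snd r2"])
      (auto simp: mob_mirror[of \<beta>3 \<beta>2] mob_mirror[of \<beta>2 \<beta>1] mob_mirror[of \<beta>3 \<beta>1]
        mob_den_mirror[of \<beta>3 \<beta>2] mob_den_mirror[of \<beta>2 \<beta>1] mob_den_mirror[of \<beta>3 \<beta>1])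
  then have 2: "r2' = t2"
    by (simp add: r2'_def t2_def flip_def prod_eq_iff sel(5,6)
        mob_mirror[of \<beta>3 \<beta>2] mob_mirror[of \<beta>2 \<beta>1] mob_mirror[of \<beta>3 \<beta>1])
  show ?thesis
    unfolding left right 1 2 ..
qed

section \<open>Open dense sets and homeomorphisms\<close>

lemma dense_Int_open_dense:
  fixes S T :: "'a::topological_space set"
  assumes "open S" "closure S = UNIV" "closure T = UNIV"
  shows "closure (S \<inter> T) = UNIV"
proof -
  have "S \<subseteq> closure (S \<inter> T)"
    using open_Int_closure_subset[OF assms(1), of T] assms(3) by simp
  then have "closure S \<subseteq> closure (S \<inter> T)"
    by (rule closure_minimal) simp
  then show ?thesis using assms(2) by auto
qed

text \<open>
  A continuous preimage of a dense set need not be dense; here an open set avoiding the preimage would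
  have an open image avoiding \<open>S\<close>.
\<close>

lemma homeomorphism_pullback_open_dense:
  fixes f :: "'a::topological_space \<Rightarrow> 'b::topological_space"
  assumes hom: "homeomorphism U V f g" and U: "open U" "closure U = UNIV" and V: "open V"
    and S: "open S" "closure S = UNIV"
  shows "open {x \<in> U. f x \<in> S}" "closure {x \<in> U. f x \<in> S} = UNIV"
proof -
  have eq: "{x \<in> U. f x \<in> S} = U \<inter> f -` S" by auto
  show "open {x \<in> U. f x \<in> S}"
    unfolding eq using hom U(1) S(1) by (intro continuous_open_preimage) (auto simp: homeomorphism_def)
  show "closure {x \<in> U. f x \<in> S} = UNIV"
  proof (rule ccontr)
    assume "closure {x \<in> U. f x \<in> S} \<noteq> UNIV"
    define W where "W = - closure {x \<in> U. f x \<in> S}"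
    have W: "open W" "W \<noteq> {}"
      using \<open>closure _ \<noteq> UNIV\<close> by (auto simp: W_def)
    have "U \<inter> W \<noteq> {}"
      using W U(2) open_Int_closure_eq_empty[of W U] by auto
    have "openin (top_of_set V) (f ` (U \<inter> W))"
      using hom W(1) by (intro homeomorphism_imp_open_map) auto
    then have "open (f ` (U \<inter> W))"
      using V openin_open_trans by blast
    moreover have "f ` (U \<inter> W) \<noteq> {}" using \<open>U \<inter> W \<noteq> {}\<close> by simp
    ultimately have "f ` (U \<inter> W) \<inter> S \<noteq> {}"
      using open_Int_closure_eq_empty[of "f ` (U \<inter> W)" S] S(2) by simp
    then obtain x where "x \<in> U" "x \<in> W" "f x \<in> S" by auto
    then show False
      using closure_subset[of "{x \<in> U. f x \<in> S}"] by (auto simp: W_def)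
  qed
qed

lemma dense_linear_neq_0:
  fixes f :: "'a::real_normed_vector \<Rightarrow> 'b::real_vector"
  assumes "linear f" "f b \<noteq> 0"
  shows "closure {x. f x \<noteq> 0} = UNIV"
proof -
  have "x \<in> closure {x. f x \<noteq> 0}" for x
  proof (cases "f x = 0")
    case True
    define s where "s n = x + inverse (real (Suc n)) *\<^sub>R b" for n
    have "s \<longlonglongrightarrow> x + 0 *\<^sub>R b"
      unfolding s_def by (intro tendsto_intros LIMSEQ_inverse_real_of_nat)
    then have "s \<longlonglongrightarrow> x" by simp
    moreover have "s n \<in> {x. f x \<noteq> 0}" for n
      using assms True by (simp add: s_def linear_add linear_scale del: of_nat_Suc)
    ultimately show ?thesis
      unfolding closure_sequential by (intro exI[of _ s]) simp
  next
    case False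
    then show ?thesis using closure_subset[of "{x. f x \<noteq> 0}"] by auto
  qed
  then show ?thesis by blast
qed

lemma open_dom:
  fixes D :: "('a::topological_space \<times> 'a) set"
  assumes "open D"
  shows "open (dom12 D)" "open (dom13 D)" "open (dom23 D)"
proof -
  have "dom12 D = (\<lambda>t. (fst t, fst (snd t))) -` D" "dom13 D = (\<lambda>t. (fst t, snd (snd t))) -` D"
    "dom23 D = snd -` D"
    by (auto simp: dom12_def dom13_def dom23_def)
  then show "open (dom12 D)" "open (dom13 D)" "open (dom23 D)"
    using assms by (auto intro!: open_vimage continuous_intros)
qed

lemma dense_dom:
  fixes D :: "('a::topological_space \<times> 'a) set"
  assumes "closure D = UNIV"
  shows "closure (dom12 D) = UNIV" "closure (dom13 D) = UNIV" "closure (dom23 D) = UNIV"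
proof -
  have "(\<lambda>p. (fst p, snd p, z)) ` closure D \<subseteq> closure (dom12 D)" for z
    by (rule image_closure_subset)
      (auto intro!: continuous_intros closure_subset[THEN subsetD] simp: dom12_def)
  then show "closure (dom12 D) = UNIV"
    unfolding assms by (force simp: image_subset_iff)
  have "(\<lambda>p. (fst p, y, snd p)) ` closure D \<subseteq> closure (dom13 D)" for y
    by (rule image_closure_subset)
      (auto intro!: continuous_intros closure_subset[THEN subsetD] simp: dom13_def)
  then show "closure (dom13 D) = UNIV"
    unfolding assms by (force simp: image_subset_iff)
  have "Pair x ` closure D \<subseteq> closure (dom23 D)" for x
    by (rule image_closure_subset)
      (auto intro!: continuous_intros closure_subset[THEN subsetD] simp: dom23_def)
  then show "closure (dom23 D) = UNIV"
    unfolding assms by (force simp: image_subset_iff)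
qed

lemma homeomorphism_act:
  fixes f g :: "'a::topological_space \<times> 'a \<Rightarrow> 'a \<times> 'a"
  assumes "homeomorphism D E f g"
  shows "homeomorphism (dom12 D) (dom12 E) (act12 f) (act12 g)"
    and "homeomorphism (dom13 D) (dom13 E) (act13 f) (act13 g)"
    and "homeomorphism (dom23 D) (dom23 E) (act23 f) (act23 g)"
proof -
  have fg: "continuous_on D f" "continuous_on E g"
    "\<And>x. x \<in> D \<Longrightarrow> f x \<in> E" "\<And>y. y \<in> E \<Longrightarrow> g y \<in> D"
    "\<And>x. x \<in> D \<Longrightarrow> g (f x) = x" "\<And>y. y \<in> E \<Longrightarrow> f (g y) = y"
    using assms by (auto simp: homeomorphism_def)
  have act: "act12 h = (\<lambda>t. let w = h (fst t, fst (snd t)) in (fst w, snd w, snd (snd t)))"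
    "act13 h = (\<lambda>t. let w = h (fst t, snd (snd t)) in (fst w, fst (snd t), snd w))"
    "act23 h = (\<lambda>t. (fst t, h (snd t)))" for h :: "'a \<times> 'a \<Rightarrow> 'a \<times> 'a"
    by (auto simp: act12_def act13_def act23_def fun_eq_iff Let_def split: prod.splits)
  have cont: "continuous_on (dom12 D) (act12 h)" "continuous_on (dom13 D) (act13 h)"
    "continuous_on (dom23 D) (act23 h)"
    if h: "continuous_on D h" for D and h :: "'a \<times> 'a \<Rightarrow> 'a \<times> 'a"
    unfolding act Let_def
    by (intro continuous_intros continuous_on_compose2[OF h];
        auto simp: dom12_def dom13_def dom23_def)+
  have inv: "act12 h t \<in> dom12 D'" "act12 k (act12 h t) = t" if "t \<in> dom12 D"
    "\<And>x. x \<in> D \<Longrightarrow> h x \<in> D'" "\<And>x. x \<in> D \<Longrightarrow> k (h x) = x"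
    for h k and t :: "'a \<times> 'a \<times> 'a" and D D'
    using that by (auto simp: act dom12_def Let_def split: prod.splits)
  have inv': "act13 h t \<in> dom13 D'" "act13 k (act13 h t) = t" if "t \<in> dom13 D"
    "\<And>x. x \<in> D \<Longrightarrow> h x \<in> D'" "\<And>x. x \<in> D \<Longrightarrow> k (h x) = x"
    for h k and t :: "'a \<times> 'a \<times> 'a" and D D'
    using that by (auto simp: act dom13_def Let_def split: prod.splits)
  have inv'': "act23 h t \<in> dom23 D'" "act23 k (act23 h t) = t" if "t \<in> dom23 D"
    "\<And>x. x \<in> D \<Longrightarrow> h x \<in> D'" "\<And>x. x \<in> D \<Longrightarrow> k (h x) = x"
    for h k and t :: "'a \<times> 'a \<times> 'a" and D D'
    using that by (auto simp: act dom23_def Let_def split: prod.splits)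
  show "homeomorphism (dom12 D) (dom12 E) (act12 f) (act12 g)"
    by (rule homeomorphismI)
      (auto simp: image_subset_iff cont fg(1,2) inv[OF _ fg(3) fg(5)] inv[OF _ fg(4) fg(6)])
  show "homeomorphism (dom13 D) (dom13 E) (act13 f) (act13 g)"
    by (rule homeomorphismI)
      (auto simp: image_subset_iff cont fg(1,2) inv'[OF _ fg(3) fg(5)] inv'[OF _ fg(4) fg(6)])
  show "homeomorphism (dom23 D) (dom23 E) (act23 f) (act23 g)"
    by (rule homeomorphismI)
      (auto simp: image_subset_iff cont fg(1,2) inv''[OF _ fg(3) fg(5)] inv''[OF _ fg(4) fg(6)])
qed

section \<open>Density of the domains\<close>

lemma yb_R_dom_eq:
  assumes "\<beta>1 \<noteq> 0" "\<beta>2 \<noteq> 0"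
  shows "yb_R_dom \<beta>1 \<beta>2 = {t. \<beta>1 * fst (fst t) * (snd (snd t) - 1) + \<beta>2 * (1 + fst (fst t)) \<noteq> 0 \<and>
    \<beta>1 * (1 - snd (snd t)) + \<beta>2 * snd (snd t) * (1 + fst (fst t)) \<noteq> 0 \<and>
    1 + fst (fst t) \<noteq> 0 \<and> 1 - snd (snd t) \<noteq> 0 \<and> 1 + fst (fst t) * snd (snd t) \<noteq> 0}"
proof -
  have "t \<in> yb_R_dom \<beta>1 \<beta>2 \<longleftrightarrow> \<beta>1 * fst (fst t) * (snd (snd t) - 1) + \<beta>2 * (1 + fst (fst t)) \<noteq> 0 \<and>
    \<beta>1 * (1 - snd (snd t)) + \<beta>2 * snd (snd t) * (1 + fst (fst t)) \<noteq> 0 \<and>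
    1 + fst (fst t) \<noteq> 0 \<and> 1 - snd (snd t) \<noteq> 0 \<and> 1 + fst (fst t) * snd (snd t) \<noteq> 0" for t
    using yb_R_dom_iff[OF assms, of "fst (fst t)" "snd (fst t)" "fst (snd t)" "snd (snd t)"]
    by (simp add: yb_den_def yb_num_def case_prod_unfold)
  then show ?thesis by blast
qed

lemma open_yb_R_dom:
  assumes "\<beta>1 \<noteq> 0" "\<beta>2 \<noteq> 0"
  shows "open (yb_R_dom \<beta>1 \<beta>2)"
  unfolding yb_R_dom_eq[OF assms]
  by (intro open_Collect_conj open_Collect_neq continuous_intros)

lemma continuous_on_yb_R: "continuous_on (yb_R_dom \<beta>1 \<beta>2) (yb_R \<beta>1 \<beta>2)"
  unfolding yb_R_def yb_R_dom_def yb_P_def yb_den_def yb_num_def Let_def case_prod_unfold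
  by (intro continuous_intros) auto

lemma eventually_affine_neq_0:
  fixes a b d :: complex
  assumes "a + b * d \<noteq> 0"
  shows "eventually (\<lambda>w. a + b * w \<noteq> 0) (at z)"
proof (cases "b = 0")
  case True
  then show ?thesis using assms by simp
next
  case False
  then have "a + b * w \<noteq> 0" if "w \<noteq> - a / b" for w
    using that by (auto simp: field_simps add_eq_0_iff)
  then show ?thesis
    by (intro eventually_mono[OF eventually_neq_at_within[of "- a / b"]])
qed

text \<open>
  The conditions involve \<open>x1\<close> and \<open>y2\<close> only.  Once \<open>1 + x1\<close> is nonzero, each of them is affine in \<open>y2\<close>
  and does not vanish identically, as its value at \<open>y2 = 1\<close> or \<open>y2 = 0\<close> shows; moving first \<open>x1\<close> and
  then \<open>y2\<close> therefore reaches the domain.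
\<close>

lemma dense_yb_R_dom:
  assumes \<beta>: "\<beta>1 \<noteq> 0" "\<beta>2 \<noteq> 0"
  shows "closure (yb_R_dom \<beta>1 \<beta>2) = UNIV"
proof -
  have slice: "((x1, x2), (y1, y2)) \<in> closure (yb_R_dom \<beta>1 \<beta>2)" if "1 + x1 \<noteq> 0" for x1 x2 y1 y2
  proof -
    have "\<forall>\<^sub>F w in at y2. (\<beta>2 * (1 + x1) - \<beta>1 * x1) + \<beta>1 * x1 * w \<noteq> 0"
      "\<forall>\<^sub>F w in at y2. \<beta>1 + (\<beta>2 * (1 + x1) - \<beta>1) * w \<noteq> 0"
      "\<forall>\<^sub>F w in at y2. 1 + (-1) * w \<noteq> 0" "\<forall>\<^sub>F w in at y2. 1 + x1 * w \<noteq> 0"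
      using that \<beta>
      by - (rule eventually_affine_neq_0[where d = 1], simp,
        (rule eventually_affine_neq_0[where d = 0], simp)+)
    then have "\<forall>\<^sub>F w in at y2. ((x1, x2), (y1, w)) \<in> yb_R_dom \<beta>1 \<beta>2"
    proof eventually_elim
      case (elim w)
      then show ?case
        unfolding yb_R_dom_iff[OF \<beta>] using that by (simp add: yb_den_def yb_num_def algebra_simps)
    qed
    moreover have "((\<lambda>w. ((x1, x2), (y1, w))) \<longlongrightarrow> ((x1, x2), (y1, y2))) (at y2)"
      by (intro tendsto_intros)
    ultimately show ?thesis
      by (intro Lim_in_closed_set[of "closure _" _ "at y2"])
        (auto elim!: eventually_mono simp: closure_subset[THEN subsetD])
  qed
  have "((x1, x2), (y1, y2)) \<in> closure (yb_R_dom \<beta>1 \<beta>2)" for x1 x2 y1 y2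
  proof -
    have "\<forall>\<^sub>F w in at x1. 1 + 1 * w \<noteq> 0"
      by (rule eventually_affine_neq_0[where d = 0]) simp
    then have "\<forall>\<^sub>F w in at x1. ((w, x2), (y1, y2)) \<in> closure (yb_R_dom \<beta>1 \<beta>2)"
      by eventually_elim (simp add: slice)
    moreover have "((\<lambda>w. ((w, x2), (y1, y2))) \<longlongrightarrow> ((x1, x2), (y1, y2))) (at x1)"
      by (intro tendsto_intros)
    ultimately show ?thesis
      by (intro Lim_in_closed_set[of "closure _" _ "at x1"]) auto
  qed
  then show ?thesis by auto
qed

text \<open>
  Reversibility: exchanging \<open>\<beta>1\<close> and \<open>\<beta>2\<close> inverts the multiplier of the flip.  The swap is needed since
  the map returns the right edge of the flipped path first.
\<close>

lemma yb_R_swap_inverse: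
  assumes \<beta>: "\<beta>1 \<noteq> 0" "\<beta>2 \<noteq> 0" and t: "t \<in> yb_R_dom \<beta>1 \<beta>2"
  shows "prod.swap (yb_R \<beta>1 \<beta>2 t) \<in> yb_R_dom \<beta>2 \<beta>1"
    and "yb_R \<beta>2 \<beta>1 (prod.swap (yb_R \<beta>1 \<beta>2 t)) = prod.swap t"
proof -
  obtain x y where xy: "t = (x, y)" by (cases t)
  define M where "M = (1 :: complex, 0 :: complex)"
  have M: "fst M \<noteq> snd M" by (simp add: M_def)
  note ne = yb_R_dom_D[OF \<beta> t[unfolded xy]]
  obtain L where L: "fst L \<noteq> snd M" "edge L M = x" using edge_extend_left[OF M ne(1)] .
  obtain R where R: "fst M \<noteq> snd R" "edge M R = y" using edge_extend_right[OF M ne(2)] .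
  define M' where "M' = flip \<beta>1 \<beta>2 L R M"
  have d: "(edge L M, edge M R) \<in> yb_R_dom \<beta>1 \<beta>2" using t by (simp add: xy L R)
  note e = yb_R_edge[OF \<beta> L(1) R(1) d M'_def]
  note nz = d[unfolded edge_in_yb_R_dom_iff[OF \<beta> L(1) R(1)]]
  have "fst M' - snd M' \<noteq> 0"
    unfolding M'_def flip_def using nz \<beta> by (simp add: mob_diff)
  then have d': "(edge L M', edge M' R) \<in> yb_R_dom \<beta>2 \<beta>1"
    unfolding edge_in_yb_R_dom_iff[OF \<beta>(2,1) e(2,3)]
    using nz \<beta> by (simp add: M'_def flip_def mob_den_mob)
  then show "prod.swap (yb_R \<beta>1 \<beta>2 t) \<in> yb_R_dom \<beta>2 \<beta>1"
    using e(1) by (simp add: xy L R)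
  have "M = flip \<beta>2 \<beta>1 L R M'"
    using nz \<beta> by (simp add: M'_def flip_def prod_eq_iff mob_inverse)
  from yb_R_edge(1)[OF \<beta>(2,1) e(2,3) d' this]
  show "yb_R \<beta>2 \<beta>1 (prod.swap (yb_R \<beta>1 \<beta>2 t)) = prod.swap t"
    using e(1) by (simp add: xy L R)
qed

lemma homeomorphism_yb_R:
  assumes \<beta>: "\<beta>1 \<noteq> 0" "\<beta>2 \<noteq> 0"
  shows "homeomorphism (yb_R_dom \<beta>1 \<beta>2) (prod.swap -` yb_R_dom \<beta>2 \<beta>1)
    (yb_R \<beta>1 \<beta>2) (prod.swap \<circ> yb_R \<beta>2 \<beta>1 \<circ> prod.swap)"
proof (rule homeomorphismI)
  show "continuous_on (prod.swap -` yb_R_dom \<beta>2 \<beta>1) (prod.swap \<circ> yb_R \<beta>2 \<beta>1 \<circ> prod.swap)"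
    by (intro continuous_on_compose continuous_on_swap)
      (auto intro: continuous_on_subset[OF continuous_on_yb_R])
qed (use yb_R_swap_inverse[OF \<beta>] yb_R_swap_inverse[OF \<beta>(2,1)] continuous_on_yb_R in auto)

text \<open>
  The domain of a threefold composition is an iterated pullback of the domain of the last factor.
\<close>

lemma open_dense_yb_domains:
  assumes \<beta>: "\<beta>1 \<noteq> 0" "\<beta>2 \<noteq> 0" "\<beta>3 \<noteq> 0"
  shows "open (yb_left_dom \<beta>1 \<beta>2 \<beta>3)" "closure (yb_left_dom \<beta>1 \<beta>2 \<beta>3) = UNIV"
    and "closure (yb_right_dom \<beta>1 \<beta>2 \<beta>3) = UNIV"
proof -
  have op: "open (prod.swap -` yb_R_dom b a)" if "a \<noteq> 0" "b \<noteq> 0" for a b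
    by (rule open_vimage[OF open_yb_R_dom[OF that(2,1)] continuous_on_swap])
  note od = open_dom[OF open_yb_R_dom] dense_dom[OF dense_yb_R_dom]
  have pb12: "open {t \<in> dom12 (yb_R_dom a b). act12 (yb_R a b) t \<in> S} \<and>
      closure {t \<in> dom12 (yb_R_dom a b). act12 (yb_R a b) t \<in> S} = UNIV"
    if "a \<noteq> 0" "b \<noteq> 0" "open S" "closure S = UNIV" for a b S
    using homeomorphism_pullback_open_dense[OF
        homeomorphism_act(1)[OF homeomorphism_yb_R[OF that(1,2)]]
        od(1)[OF that(1,2)] od(4)[OF that(1,2)] open_dom(1)[OF op[OF that(1,2)]] that(3,4)]
    by blast
  have pb13: "open {t \<in> dom13 (yb_R_dom a b). act13 (yb_R a b) t \<in> S} \<and>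
      closure {t \<in> dom13 (yb_R_dom a b). act13 (yb_R a b) t \<in> S} = UNIV"
    if "a \<noteq> 0" "b \<noteq> 0" "open S" "closure S = UNIV" for a b S
    using homeomorphism_pullback_open_dense[OF
        homeomorphism_act(2)[OF homeomorphism_yb_R[OF that(1,2)]]
        od(2)[OF that(1,2)] od(5)[OF that(1,2)] open_dom(2)[OF op[OF that(1,2)]] that(3,4)]
    by blast
  have pb23: "open {t \<in> dom23 (yb_R_dom a b). act23 (yb_R a b) t \<in> S} \<and>
      closure {t \<in> dom23 (yb_R_dom a b). act23 (yb_R a b) t \<in> S} = UNIV"
    if "a \<noteq> 0" "b \<noteq> 0" "open S" "closure S = UNIV" for a b S
    using homeomorphism_pullback_open_dense[OF
        homeomorphism_act(3)[OF homeomorphism_yb_R[OF that(1,2)]]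
        od(3)[OF that(1,2)] od(6)[OF that(1,2)] open_dom(3)[OF op[OF that(1,2)]] that(3,4)]
    by blast
  have l: "yb_left_dom \<beta>1 \<beta>2 \<beta>3 = {t \<in> dom12 (yb_R_dom \<beta>1 \<beta>2). act12 (yb_R \<beta>1 \<beta>2) t \<in>
      {t \<in> dom13 (yb_R_dom \<beta>1 \<beta>3). act13 (yb_R \<beta>1 \<beta>3) t \<in> dom23 (yb_R_dom \<beta>2 \<beta>3)}}"
    by (auto simp: yb_left_dom_def)
  have r: "yb_right_dom \<beta>1 \<beta>2 \<beta>3 = {t \<in> dom23 (yb_R_dom \<beta>2 \<beta>3). act23 (yb_R \<beta>2 \<beta>3) t \<in>
      {t \<in> dom13 (yb_R_dom \<beta>1 \<beta>3). act13 (yb_R \<beta>1 \<beta>3) t \<in> dom12 (yb_R_dom \<beta>1 \<beta>2)}}"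
    by (auto simp: yb_right_dom_def)
  show "open (yb_left_dom \<beta>1 \<beta>2 \<beta>3)" "closure (yb_left_dom \<beta>1 \<beta>2 \<beta>3) = UNIV"
    "closure (yb_right_dom \<beta>1 \<beta>2 \<beta>3) = UNIV"
    unfolding l r
    using pb12[OF \<beta>(1,2) pb13[OF \<beta>(1,3) od(3,6)[OF \<beta>(2,3)], THEN conjunct1]
        pb13[OF \<beta>(1,3) od(3,6)[OF \<beta>(2,3)], THEN conjunct2]]
      pb23[OF \<beta>(2,3) pb13[OF \<beta>(1,3) od(1,4)[OF \<beta>(1,2)], THEN conjunct1]
        pb13[OF \<beta>(1,3) od(1,4)[OF \<beta>(1,2)], THEN conjunct2]]
    by (simp_all only:)
qed

section \<open>The lattice system\<close>

text \<open>
  The right-hand sides of the system are the displacements \<open>mob - z\<close> of the two components of the middle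
  vertex.
\<close>

lemma square_system_iff:
  assumes \<beta>: "\<beta>1 \<noteq> 0" "\<beta>2 \<noteq> 0"
    and nz: "\<beta>2 * (u + v2) + \<beta>1 * (u1 - u) \<noteq> 0" "\<beta>1 * (v + u1) + \<beta>2 * (v2 - v) \<noteq> 0"
  shows "square_system \<beta>1 \<beta>2 u v u1 v2 u12 v12 \<longleftrightarrow>
    (u12, - v12) = flip \<beta>1 \<beta>2 (u1, - v1) (u2, - v2) (u, - v)"
proof -
  have den: "mob_den \<beta>1 \<beta>2 u1 (- v2) u = \<beta>2 * (u + v2) + \<beta>1 * (u1 - u)"
    "mob_den \<beta>1 \<beta>2 u1 (- v2) (- v) = \<beta>1 * (v + u1) + \<beta>2 * (v2 - v)"
    by (simp_all add: mob_den_def algebra_simps)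
  have c: "(1 / \<beta>1 - 1 / \<beta>2) * (\<beta>1 * \<beta>2 * w * w' / n) = (\<beta>2 - \<beta>1) * w * w' / n"
    "(1 / \<beta>2 - 1 / \<beta>1) * (\<beta>1 * \<beta>2 * w * w' / n) = (\<beta>1 - \<beta>2) * w * w' / n" for w w' n
  proof -
    have "(1 / \<beta>1 - 1 / \<beta>2) * (\<beta>1 * \<beta>2) = \<beta>2 - \<beta>1" "(1 / \<beta>2 - 1 / \<beta>1) * (\<beta>1 * \<beta>2) = \<beta>1 - \<beta>2"
      using \<beta> by (simp_all add: field_simps)
    then show "(1 / \<beta>1 - 1 / \<beta>2) * (\<beta>1 * \<beta>2 * w * w' / n) = (\<beta>2 - \<beta>1) * w * w' / n"
      "(1 / \<beta>2 - 1 / \<beta>1) * (\<beta>1 * \<beta>2 * w * w' / n) = (\<beta>1 - \<beta>2) * w * w' / n"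
      by (metis mult.assoc times_divide_eq_right)+
  qed
  have "mob \<beta>1 \<beta>2 u1 (- v2) u - u =
      (\<beta>2 - \<beta>1) * (u + v2) * (u1 - u) / (\<beta>2 * (u + v2) + \<beta>1 * (u1 - u))"
    using mob_displacement[of \<beta>1 \<beta>2 u1 "- v2" u] nz(1) by (simp add: den)
  moreover have "mob \<beta>1 \<beta>2 u1 (- v2) (- v) - (- v) =
      - ((\<beta>1 - \<beta>2) * (v + u1) * (v2 - v) / (\<beta>1 * (v + u1) + \<beta>2 * (v2 - v)))"
  proof -
    have "(\<beta>2 - \<beta>1) * (- v - - v2) * (u1 - - v) = - ((\<beta>1 - \<beta>2) * (v + u1) * (v2 - v))"
      by (simp add: algebra_simps)
    then show ?thesis
      using mob_displacement[of \<beta>1 \<beta>2 u1 "- v2" "- v"] nz(2)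
        by (simp only: den minus_divide_left not_False_eq_True)
  qed
  moreover have "m = w + d" if "m - w = d" for m w d :: complex
    using that by (simp add: diff_eq_eq add.commute)
  moreover have "- m = w + d" if "m - (- w) = - d" for m w d :: complex
    using that by algebra
  ultimately have 1: "mob \<beta>1 \<beta>2 u1 (- v2) u =
      u + (\<beta>2 - \<beta>1) * (u + v2) * (u1 - u) / (\<beta>2 * (u + v2) + \<beta>1 * (u1 - u))"
    and 2: "- mob \<beta>1 \<beta>2 u1 (- v2) (- v) =
      v + (\<beta>1 - \<beta>2) * (v + u1) * (v2 - v) / (\<beta>1 * (v + u1) + \<beta>2 * (v2 - v))"
    by blast+
  show ?thesis
    unfolding square_system_def c 1[symmetric] 2[symmetric]
    by (auto simp: flip_def minus_equation_iff[of v12])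
qed

lemma edge1_eq_edge: "edge1 u v u1 v1 = edge (u1, - v1) (u, - v)"
  by (simp add: edge1_def edge_def add.commute)

lemma edge2_eq_edge: "edge2 u v u2 v2 = edge (u, - v) (u2, - v2)"
  by (simp add: edge2_def edge_def)

lemma square_edges_yb_R:
  assumes \<beta>: "\<beta>1 \<noteq> 0" "\<beta>2 \<noteq> 0"
    and sys: "square_system \<beta>1 \<beta>2 u v u1 v2 u12 v12"
    and def: "square_defined \<beta>1 \<beta>2 u v u1 v1 u2 v2 u12 v12"
  shows "(edge1 u2 v2 u12 v12, edge2 u1 v1 u12 v12) =
    yb_R \<beta>1 \<beta>2 (edge1 u v u1 v1, edge2 u v u2 v2)"
proof -
  have nz: "\<beta>2 * (u + v2) + \<beta>1 * (u1 - u) \<noteq> 0" "\<beta>1 * (v + u1) + \<beta>2 * (v2 - v) \<noteq> 0"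
    "v + u1 \<noteq> 0" "u + v2 \<noteq> 0"
    and dom: "(edge (u1, - v1) (u, - v), edge (u, - v) (u2, - v2)) \<in> yb_R_dom \<beta>1 \<beta>2"
    using def by (simp_all add: square_defined_def edge1_eq_edge edge2_eq_edge)
  have "fst (u1, - v1) \<noteq> snd (u, - v)" "fst (u, - v) \<noteq> snd (u2, - v2)"
    using nz by (auto simp: add_eq_0_iff)
  from yb_R_edge(1)[OF \<beta> this dom square_system_iff[OF \<beta> nz(1,2), THEN iffD1, OF sys]]
  show ?thesis
    by (simp add: edge1_eq_edge edge2_eq_edge)
qed

text \<open>
  Everything is defined as soon as six nonzero linear forms in the fields do not vanish: the conditions on
  \<open>u12\<close> and \<open>v12\<close> follow from the others by \<open>yb_R_edge\<close>.
\<close>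

lemma dense_square_defined:
  assumes \<beta>: "\<beta>1 \<noteq> 0" "\<beta>2 \<noteq> 0"
  shows "closure {(u, v, u1, v1, u2, v2). \<exists>u12 v12 :: complex.
    square_system \<beta>1 \<beta>2 u v u1 v2 u12 v12 \<and>
    square_defined \<beta>1 \<beta>2 u v u1 v1 u2 v2 u12 v12} = UNIV" (is "closure ?S = UNIV")
proof -
  define forms :: "(complex \<times> complex \<times> complex \<times> complex \<times> complex \<times> complex \<Rightarrow> complex) set"
    where "forms = {\<lambda>(u, v, u1, v1, u2, v2). \<beta>2 * (u + v2) + \<beta>1 * (u1 - u),
      \<lambda>(u, v, u1, v1, u2, v2). \<beta>1 * (v + u1) + \<beta>2 * (v2 - v),
      \<lambda>(u, v, u1, v1, u2, v2). v + u1, \<lambda>(u, v, u1, v1, u2, v2). u + v2,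
      \<lambda>(u, v, u1, v1, u2, v2). u + v, \<lambda>(u, v, u1, v1, u2, v2). u1 + v2}"
  have lin: "linear f" if "f \<in> forms" for f
    using that unfolding forms_def
    by (auto intro!: linearI simp: algebra_simps scaleR_conv_of_real)
  have nonzero: "\<exists>b. f b \<noteq> 0" if "f \<in> forms" for f
  proof -
    \<comment> \<open>Each form depends on u1 or on u; the first two have the coefficient \<open>\<beta>1\<close> at u1.\<close>
    have "f (0, 0, 1, 0, 0, 0) \<noteq> 0 \<or> f (1, 0, 0, 0, 0, 0) \<noteq> 0"
      using that \<beta> by (auto simp: forms_def)
    then show ?thesis by blast
  qed
  have "finite F \<Longrightarrow> F \<subseteq> forms \<Longrightarrow>
    open (\<Inter>f\<in>F. {t. f t \<noteq> 0}) \<and> closure (\<Inter>f\<in>F. {t. f t \<noteq> 0}) = UNIV" for F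
  proof (induction F rule: finite_induct)
    case (insert f F)
    have "linear f" using insert.prems lin by blast
    then have "open {t. f t \<noteq> 0}"
      by (intro open_Collect_neq linear_continuous_on continuous_on_const)
        (simp add: linear_conv_bounded_linear)
    moreover have "closure {t. f t \<noteq> 0} = UNIV"
      using \<open>linear f\<close> nonzero[of f] insert.prems dense_linear_neq_0 by blast
    ultimately show ?case
      using insert by (simp add: open_Int dense_Int_open_dense)
  qed simp
  from this[of forms] have "closure (\<Inter>f\<in>forms. {t. f t \<noteq> 0}) = UNIV"
    by (simp add: forms_def)
  moreover have "closure (\<Inter>f\<in>forms. {t. f t \<noteq> 0}) \<subseteq> closure ?S"
  proof (rule closure_mono)
    show "(\<Inter>f\<in>forms. {t. f t \<noteq> 0}) \<subseteq> ?S"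
    proof
      fix t assume "t \<in> (\<Inter>f\<in>forms. {t. f t \<noteq> 0})"
      moreover obtain u v u1 v1 u2 v2 where t: "t = (u, v, u1, v1, u2, v2)" by (cases t)
      ultimately have nz: "\<beta>2 * (u + v2) + \<beta>1 * (u1 - u) \<noteq> 0" "\<beta>1 * (v + u1) + \<beta>2 * (v2 - v) \<noteq> 0"
        "v + u1 \<noteq> 0" "u + v2 \<noteq> 0" "u + v \<noteq> 0" "u1 + v2 \<noteq> 0"
        by (simp_all add: forms_def)
      define L M R where LMR: "L = (u1, - v1)" "M = (u, - v)" "R = (u2, - v2)"
      have ne: "fst L \<noteq> snd M" "fst M \<noteq> snd R" "fst M \<noteq> snd M" "fst L \<noteq> snd R"
        using nz by (auto simp: LMR add_eq_0_iff)
      have "mob_den \<beta>1 \<beta>2 (fst L) (snd R) (fst M) \<noteq> 0" "mob_den \<beta>1 \<beta>2 (fst L) (snd R) (snd M) \<noteq> 0"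
        using nz(1,2) by (simp_all add: LMR mob_den_def algebra_simps)
      then have dom: "(edge L M, edge M R) \<in> yb_R_dom \<beta>1 \<beta>2"
        unfolding edge_in_yb_R_dom_iff[OF \<beta> ne(1,2)] using ne by blast
      define M' where "M' = flip \<beta>1 \<beta>2 L R M"
      define u12 v12 where "u12 = fst M'" and "v12 = - snd M'"
      have "(u12, - v12) = flip \<beta>1 \<beta>2 L R M"
        by (simp add: u12_def v12_def M'_def)
      then have "square_system \<beta>1 \<beta>2 u v u1 v2 u12 v12"
        unfolding LMR by (rule square_system_iff[OF \<beta> nz(1,2), THEN iffD2])
      moreover have "v2 + u12 \<noteq> 0" "u1 + v12 \<noteq> 0"
        using yb_R_edge(2,3)[OF \<beta> ne(1,2) dom M'_def]
        by (auto simp: u12_def v12_def LMR add_eq_0_iff)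
      ultimately have "square_system \<beta>1 \<beta>2 u v u1 v2 u12 v12 \<and>
          square_defined \<beta>1 \<beta>2 u v u1 v1 u2 v2 u12 v12"
        using nz dom by (simp add: square_defined_def edge1_eq_edge edge2_eq_edge LMR)
      then show "t \<in> ?S" unfolding t by blast
    qed
  qed
  ultimately show ?thesis
    by (simp only: top.extremum_unique)
qed

theorem mainTheorem9:
  shows
    "(\<forall>\<beta>1 \<beta>2 :: complex. \<beta>1 \<noteq> 0 \<longrightarrow> \<beta>2 \<noteq> 0 \<longrightarrow>
        (\<forall>u v u1 v1 u2 v2 u12 v12 :: complex.
           square_system \<beta>1 \<beta>2 u v u1 v2 u12 v12 \<longrightarrow>
           square_defined \<beta>1 \<beta>2 u v u1 v1 u2 v2 u12 v12 \<longrightarrow>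
           (edge1 u2 v2 u12 v12, edge2 u1 v1 u12 v12) =
             yb_R \<beta>1 \<beta>2 (edge1 u v u1 v1, edge2 u v u2 v2)) \<and>
        closure {(u, v, u1, v1, u2, v2). \<exists>u12 v12 :: complex.
           square_system \<beta>1 \<beta>2 u v u1 v2 u12 v12 \<and>
           square_defined \<beta>1 \<beta>2 u v u1 v1 u2 v2 u12 v12} = UNIV)
     \<and>
     (\<forall>\<beta>1 \<beta>2 \<beta>3 :: complex. \<beta>1 \<noteq> 0 \<longrightarrow> \<beta>2 \<noteq> 0 \<longrightarrow> \<beta>3 \<noteq> 0 \<longrightarrow>
        (\<forall>t \<in> yb_left_dom \<beta>1 \<beta>2 \<beta>3 \<inter> yb_right_dom \<beta>1 \<beta>2 \<beta>3.
           (act23 (yb_R \<beta>2 \<beta>3) \<circ> act13 (yb_R \<beta>1 \<beta>3) \<circ> act12 (yb_R \<beta>1 \<beta>2)) t =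
           (act12 (yb_R \<beta>1 \<beta>2) \<circ> act13 (yb_R \<beta>1 \<beta>3) \<circ> act23 (yb_R \<beta>2 \<beta>3)) t) \<and>
        closure (yb_left_dom \<beta>1 \<beta>2 \<beta>3 \<inter> yb_right_dom \<beta>1 \<beta>2 \<beta>3) = UNIV)"
proof (intro conjI allI impI ballI)
  fix \<beta>1 \<beta>2 :: complex assume "\<beta>1 \<noteq> 0" "\<beta>2 \<noteq> 0"
  note \<beta> = this
  show "(edge1 u2 v2 u12 v12, edge2 u1 v1 u12 v12) =
      yb_R \<beta>1 \<beta>2 (edge1 u v u1 v1, edge2 u v u2 v2)"
    if "square_system \<beta>1 \<beta>2 u v u1 v2 u12 v12" "square_defined \<beta>1 \<beta>2 u v u1 v1 u2 v2 u12 v12"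
    for u v u1 v1 u2 v2 u12 v12
    using square_edges_yb_R[OF \<beta> that] .
  show "closure {(u, v, u1, v1, u2, v2). \<exists>u12 v12 :: complex.
      square_system \<beta>1 \<beta>2 u v u1 v2 u12 v12 \<and>
      square_defined \<beta>1 \<beta>2 u v u1 v1 u2 v2 u12 v12} = UNIV"
    using dense_square_defined[OF \<beta>] .
next
  fix \<beta>1 \<beta>2 \<beta>3 :: complex assume "\<beta>1 \<noteq> 0" "\<beta>2 \<noteq> 0" "\<beta>3 \<noteq> 0"
  note \<beta> = this
  show "(act23 (yb_R \<beta>2 \<beta>3) \<circ> act13 (yb_R \<beta>1 \<beta>3) \<circ> act12 (yb_R \<beta>1 \<beta>2)) t =
      (act12 (yb_R \<beta>1 \<beta>2) \<circ> act13 (yb_R \<beta>1 \<beta>3) \<circ> act23 (yb_R \<beta>2 \<beta>3)) t"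
    if "t \<in> yb_left_dom \<beta>1 \<beta>2 \<beta>3 \<inter> yb_right_dom \<beta>1 \<beta>2 \<beta>3" for t
    using yb_R_yang_baxter[OF \<beta>] that by blast
  show "closure (yb_left_dom \<beta>1 \<beta>2 \<beta>3 \<inter> yb_right_dom \<beta>1 \<beta>2 \<beta>3) = UNIV"
    using open_dense_yb_domains[OF \<beta>] by (intro dense_Int_open_dense)
qed

end
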